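(* Let $i=\sqrt{-1}$ and let $\frac{r}{s}>1$ be an irreducible fraction. Then $J_{\frac rs}(i)=0$ if $r\equiv2\pmod4$; $J_{\frac rs}(i)\in\{\pm(1+i),\pm(1-i)\}$ if $r\equiv0\pmod4$; and $J_{\frac rs}(i)\in\{\pm1,\pm i\}$ if $r\equiv1,3\pmod4$.
   Context: For a rational $\alpha>0$, $L(\alpha)$ denotes the rational (two-bridge) link associated with $\alpha$ via its continued fraction expansion, and $V_\alpha(t)\in\mathbb Z[t^{\pm1/2}]$ its Jones polynomial. The normalized Jones polynomial is $J_\alpha(q)=\pm t^{-h}V_\alpha(t)|_{t=-q^{-1}}$, where $\pm t^h$ is the leading term of $V_\alpha(t)$. It is known that for $\alpha>1$, $J_\alpha(q)=q\mathcal{R}_\alpha(q)+(1-q)\mathcal{S}_\alpha(q)$, where: $[c]_q=\frac{1-q^c}{1-q}$; writing $\alpha=c_1-\cfrac{1}{c_2-\cfrac{1}{\ddots-\cfrac{1}{c_l}}}$ with integers $c_j\ge2$ (unique) and $M^-_q(c)=\begin{pmatrix}[c]_q & -q^{c-1}\\ 1 & 0\end{pmatrix}$, one has $\begin{pmatrix}\mathcal{R}_\alpha(q)\\ \mathcal{S}_\alpha(q)\end{pmatrix}=M^-_q(c_1)\cdots M^-_q(c_l)\begin{pmatrix}1\\0\end{pmatrix}$. An irreducible fraction $\frac rs$ means $\gcd(r,s)=1$, $s>0$. *)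

theory Defs
  imports Complex_Main "HOL-Library.Poly_Mapping" "HOL-Number_Theory.Cong"
begin

section \<open>Link diagrams\<close>

text \<open>
  A planar diagram code is a list of nodes whose arguments are labels of edges; in the code of a
  link diagram every label occurs exactly twice. \<open>Cross a b c d\<close> is a crossing whose four incident
  edges are, in counterclockwise order, \<open>a, b, c, d\<close>, where \<open>a, c\<close> belong to the under-strand and
  \<open>b, d\<close> to the over-strand. \<open>Join a b\<close> says that the edges \<open>a\<close> and \<open>b\<close> are glued end to end.
\<close>

datatype node = Cross nat nat nat nat | Join nat nat

type_synonym diagram = "node list"

primrec node_labels :: "node \<Rightarrow> nat set" where
  "node_labels (Cross a b c d) = {a, b, c, d}"
| "node_labels (Join a b) = {a, b}"

definition labels :: "diagram \<Rightarrow> nat set" where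
  "labels D = (\<Union>x\<in>set D. node_labels x)"

section \<open>Kauffman bracket and Jones polynomial\<close>

text \<open>
  Laurent polynomials with integer coefficients are the group ring of the integers,
  \<^typ>\<open>int \<Rightarrow>\<^sub>0 int\<close>.
\<close>

type_synonym laurent = "int \<Rightarrow>\<^sub>0 int"

text \<open>
  The Kauffman states of a diagram. A state is recorded as the number of \<open>A\<close>-smoothings minus the
  number of \<open>B\<close>-smoothings, together with the pairs of edges that it connects. The two regions
  swept out when the over-strand \<open>b d\<close> is turned counterclockwise are those between \<open>b, c\<close> and
  between \<open>d, a\<close>; the \<open>A\<close>-smoothing merges them, so it connects \<open>a\<close> with \<open>b\<close> and \<open>c\<close> with \<open>d\<close>.
\<close>

fun states :: "diagram \<Rightarrow> (int \<times> (nat \<times> nat) set) list" where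
  "states [] = [(0, {})]"
| "states (Cross a b c d # D) =
     map (\<lambda>(k, G). (k + 1, {(a, b), (c, d)} \<union> G)) (states D) @
     map (\<lambda>(k, G). (k - 1, {(a, d), (b, c)} \<union> G)) (states D)"
| "states (Join a b # D) = map (\<lambda>(k, G). (k, {(a, b)} \<union> G)) (states D)"

definition loops :: "nat set \<Rightarrow> (nat \<times> nat) set \<Rightarrow> nat" where
  "loops L G = card ((\<lambda>v. (G \<union> G\<inverse>)\<^sup>* `` {v}) ` L)"

definition loop_value :: laurent where
  "loop_value = - Poly_Mapping.single 2 1 - Poly_Mapping.single (-2) 1"

definition bracket :: "diagram \<Rightarrow> laurent" where
  "bracket D =
     (\<Sum>(k, G)\<leftarrow>states D. Poly_Mapping.single k 1 * loop_value ^ (loops (labels D) G - 1))"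

text \<open>
  An orientation of a diagram gives a pair of directions \<open>(u, v)\<close> for each node. At \<open>Cross a b c d\<close>
  the under-strand runs from \<open>a\<close> to \<open>c\<close> if \<open>u\<close> and from \<open>c\<close> to \<open>a\<close> otherwise, and the over-strand runs
  from \<open>d\<close> to \<open>b\<close> if \<open>v\<close> and from \<open>b\<close> to \<open>d\<close> otherwise; so the crossing is positive iff \<open>u = v\<close>.
  At \<open>Join a b\<close> the strand runs from \<open>a\<close> to \<open>b\<close> if \<open>u\<close> and from \<open>b\<close> to \<open>a\<close> otherwise, and \<open>v\<close> is
  ignored. As each label occurs twice, the directions fit together iff no edge enters two nodes
  and no edge leaves two nodes.
\<close>

type_synonym direction = "bool \<times> bool"

fun node_in :: "node \<Rightarrow> direction \<Rightarrow> nat list" where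
  "node_in (Cross a b c d) (u, v) = [if u then a else c, if v then d else b]"
| "node_in (Join a b) (u, v) = [if u then a else b]"

fun node_out :: "node \<Rightarrow> direction \<Rightarrow> nat list" where
  "node_out (Cross a b c d) (u, v) = [if u then c else a, if v then b else d]"
| "node_out (Join a b) (u, v) = [if u then b else a]"

fun node_sign :: "node \<Rightarrow> direction \<Rightarrow> int" where
  "node_sign (Cross a b c d) (u, v) = (if u = v then 1 else -1)"
| "node_sign (Join a b) (u, v) = 0"

definition is_orientation :: "diagram \<Rightarrow> direction list \<Rightarrow> bool" where
  "is_orientation D ds \<longleftrightarrow> length ds = length D \<and>
     distinct (concat (map2 node_in D ds)) \<and> distinct (concat (map2 node_out D ds))"

definition writhe :: "diagram \<Rightarrow> direction list \<Rightarrow> int" where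
  "writhe D ds = sum_list (map2 node_sign D ds)"

text \<open>
  The Jones polynomial is \<open>(- A\<^sup>3)\<^sup>-\<^sup>w\<langle>D\<rangle>\<close>, with \<open>w\<close> the writhe, after substituting \<open>t = A\<^sup>-\<^sup>4\<close>. It is
  stored as a Laurent polynomial in \<open>t\<^sup>1\<^sup>/\<^sup>2 = A\<^sup>-\<^sup>2\<close>: the coefficient at index \<open>n\<close> is that of \<open>t\<^sup>n\<^sup>/\<^sup>2\<close>.
\<close>

definition jones :: "diagram \<Rightarrow> direction list \<Rightarrow> laurent" where
  "jones D ds = Poly_Mapping.map_key (\<lambda>n. - 2 * n)
     (Poly_Mapping.single (- 3 * writhe D ds) ((-1) ^ nat \<bar>writhe D ds\<bar>) * bracket D)"

text \<open>
  The function \<open>q \<mapsto> \<plusminus> t\<^sup>-\<^sup>h V(t)\<close> at \<open>t = - q\<^sup>-\<^sup>1\<close>, where \<open>\<plusminus> t\<^sup>h\<close> is the leading term of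
  the Jones polynomial \<open>V\<close> and \<open>h = m / 2\<close>. All exponents of \<open>t\<close> in \<open>V\<close> are congruent modulo 1.
\<close>

definition normalized_jones :: "diagram \<Rightarrow> direction list \<Rightarrow> complex \<Rightarrow> complex" where
  "normalized_jones D ds q =
     (let V = jones D ds; m = Max (Poly_Mapping.keys V) in
        of_int (sgn (Poly_Mapping.lookup V m)) *
        (\<Sum>n\<in>Poly_Mapping.keys V.
           of_int (Poly_Mapping.lookup V n) * (- inverse q) powi ((n - m) div 2)))"

section \<open>Rational links\<close>

fun cfrac :: "nat \<Rightarrow> nat \<Rightarrow> nat list" where
  "cfrac r s = (if s = 0 then [] else r div s # cfrac s (r mod s))"

declare cfrac.simps [simp del]

text \<open>The continued fraction \<open>a\<^sub>1 + 1/(a\<^sub>2 + 1/(\<dots> + 1/a\<^sub>n))\<close>, using \<open>inverse 0 = 0\<close>.\<close>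

lemma cfrac_value:
  "s > 0 \<Longrightarrow> foldr (\<lambda>a x. of_nat a + inverse x) (cfrac r s) 0 = (of_nat r / of_nat s :: rat)"
proof (induction r s rule: cfrac.induct)
  case (1 r s)
  have eq: "of_nat r = (of_nat (r div s) * of_nat s + of_nat (r mod s) :: rat)"
    by (metis div_mult_mod_eq of_nat_add of_nat_mult)
  show ?case
  proof (cases "r mod s = 0")
    case True
    then show ?thesis
      using 1(2) eq by (simp add: cfrac.simps[of r s] cfrac.simps[of s 0])
  next
    case False
    then have "foldr (\<lambda>a x. of_nat a + inverse x) (cfrac s (r mod s)) 0 =
        (of_nat s / of_nat (r mod s) :: rat)"
      using 1 by simp
    then show ?thesis
      using 1(2) eq by (simp add: cfrac.simps[of r s] add_divide_distrib)
  qed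
qed

text \<open>A tangle with its four end edges at the corners NW, NE, SW, SE.\<close>

record tangle =
  nodes :: diagram
  nw :: nat
  ne :: nat
  sw :: nat
  se :: nat

definition zero_tangle :: tangle where
  "zero_tangle = \<lparr>nodes = [], nw = 0, ne = 0, sw = 1, se = 1\<rparr>"

definition infinity_tangle :: tangle where
  "infinity_tangle = \<lparr>nodes = [], nw = 0, ne = 1, sw = 0, se = 1\<rparr>"

text \<open>
  Every twist adds a crossing whose over-strand has positive slope: on the right of the tangle
  (turning the fraction \<open>F\<close> into \<open>F + 1\<close>), or below it (turning \<open>1/F\<close> into \<open>1/F + 1\<close>). A tangle with
  \<open>k\<close> crossings uses the edges \<open>0, \<dots>, 2 k + 1\<close>.
\<close>

definition horizontal_twist :: "tangle \<Rightarrow> tangle" where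
  "horizontal_twist T =
     (let x = 2 * length (nodes T) + 2; y = x + 1 in
        T\<lparr>nodes := Cross y x (ne T) (se T) # nodes T, ne := x, se := y\<rparr>)"

definition vertical_twist :: "tangle \<Rightarrow> tangle" where
  "vertical_twist T =
     (let x = 2 * length (nodes T) + 2; y = x + 1 in
        T\<lparr>nodes := Cross y (se T) (sw T) x # nodes T, sw := x, se := y\<rparr>)"

text \<open>
  The rational tangle of fraction \<open>[a\<^sub>1, \<dots>, a\<^sub>n]\<close> (first argument true) or of its reciprocal: \<open>a\<^sub>n\<close>
  twists, followed by \<open>a\<^sub>n\<^sub>-\<^sub>1\<close> twists of the other kind, and so on.
\<close>

fun rational_tangle :: "bool \<Rightarrow> nat list \<Rightarrow> tangle" where
  "rational_tangle hor [] = (if hor then infinity_tangle else zero_tangle)"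
| "rational_tangle hor (a # as) =
     ((if hor then horizontal_twist else vertical_twist) ^^ a) (rational_tangle (\<not> hor) as)"

definition numerator_closure :: "tangle \<Rightarrow> diagram" where
  "numerator_closure T = Join (nw T) (ne T) # Join (sw T) (se T) # nodes T"

text \<open>
  The chirality is such that \<open>rational_link 3\<close> is the left-handed trefoil, as required by
  \<open>J\<^sub>\<alpha>(q) = q \<R>\<^sub>\<alpha>(q) + (1 - q) \<S>\<^sub>\<alpha>(q)\<close>, which is \<open>1 + q\<^sup>2 + q\<^sup>3\<close> for \<open>\<alpha> = 3\<close>.
\<close>

definition rational_link :: "rat \<Rightarrow> diagram" where
  "rational_link \<alpha> =
     (case quotient_of \<alpha> of (r, s) \<Rightarrow>
        numerator_closure (rational_tangle True (cfrac (nat r) (nat s))))"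


section \<open>Rational links are orientable\<close>

text \<open>
  \<open>p\<^sub>1, \<dots>, p\<^sub>4\<close> say whether the strands at NW, NE, SW, SE are directed out of the tangle.
\<close>

definition flow :: "tangle \<Rightarrow> bool \<Rightarrow> bool \<Rightarrow> bool \<Rightarrow> bool \<Rightarrow> direction list \<Rightarrow> bool" where
  "flow T p1 p2 p3 p4 ds \<longleftrightarrow> length ds = length (nodes T) \<and>
     distinct (concat (map2 node_in (nodes T) ds) @
       (if p1 then [nw T] else []) @ (if p2 then [ne T] else []) @
       (if p3 then [sw T] else []) @ (if p4 then [se T] else [])) \<and>
     distinct (concat (map2 node_out (nodes T) ds) @
       (if p1 then [] else [nw T]) @ (if p2 then [] else [ne T]) @
       (if p3 then [] else [sw T]) @ (if p4 then [] else [se T]))"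

definition bounded_labels :: "tangle \<Rightarrow> bool" where
  "bounded_labels T \<longleftrightarrow> {nw T, ne T, sw T, se T} \<union> labels (nodes T) \<subseteq> {..<2 * length (nodes T) + 2}"

lemma node_in_subset: "set (node_in x d) \<subseteq> node_labels x"
  by (cases x; cases d) auto

lemma node_out_subset: "set (node_out x d) \<subseteq> node_labels x"
  by (cases x; cases d) auto

lemma in_subset: "set (concat (map2 node_in D ds)) \<subseteq> labels D"
  using node_in_subset by (fastforce simp: labels_def dest: set_zip_leftD)

lemma out_subset: "set (concat (map2 node_out D ds)) \<subseteq> labels D"
  using node_out_subset by (fastforce simp: labels_def dest: set_zip_leftD)

lemma bounded_labels_twist:
  assumes "bounded_labels T"
  shows "bounded_labels (horizontal_twist T)" and "bounded_labels (vertical_twist T)"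
  using assms
  by (fastforce simp: bounded_labels_def horizontal_twist_def vertical_twist_def Let_def labels_def)+

lemma flow_cons:
  fixes D ds x
  defines "I \<equiv> concat (map2 node_in D ds)" and "U \<equiv> concat (map2 node_out D ds)"
  assumes "labels D \<subseteq> {..<x}"
  shows "x \<notin> set I" "Suc x \<notin> set I" "x \<notin> set U" "Suc x \<notin> set U"
  using assms in_subset[of D ds] out_subset[of D ds] by force+

lemma flow_horizontal:
  assumes "bounded_labels T" and "flow T p1 p2 p3 p4 ds"
  shows "flow (horizontal_twist T) p1 p4 p3 p2 ((\<not> p2, p4) # ds)"
proof -
  define x where "x = 2 * length (nodes T) + 2"
  have lt: "nw T < x" "ne T < x" "sw T < x" "se T < x" "labels (nodes T) \<subseteq> {..<x}"
    using assms(1) by (auto simp: bounded_labels_def x_def)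
  define I where "I = concat (map2 node_in (nodes T) ds)"
  define U where "U = concat (map2 node_out (nodes T) ds)"
  have fresh: "x \<notin> set I" "Suc x \<notin> set I" "x \<notin> set U" "Suc x \<notin> set U"
    using flow_cons[OF lt(5), of ds] by (simp_all add: I_def U_def)
  show ?thesis
    using assms(2) lt(1-4) fresh
    unfolding flow_def horizontal_twist_def Let_def x_def[symmetric]
    by (cases p1; cases p2; cases p3; cases p4)
      (auto simp: I_def[symmetric] U_def[symmetric] simp del: set_concat)
qed

lemma flow_vertical:
  assumes "bounded_labels T" and "flow T p1 p2 p3 p4 ds"
  shows "flow (vertical_twist T) p1 p2 p4 p3 ((\<not> p3, \<not> p4) # ds)"
proof -
  define x where "x = 2 * length (nodes T) + 2"
  have lt: "nw T < x" "ne T < x" "sw T < x" "se T < x" "labels (nodes T) \<subseteq> {..<x}"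
    using assms(1) by (auto simp: bounded_labels_def x_def)
  define I where "I = concat (map2 node_in (nodes T) ds)"
  define U where "U = concat (map2 node_out (nodes T) ds)"
  have fresh: "x \<notin> set I" "Suc x \<notin> set I" "x \<notin> set U" "Suc x \<notin> set U"
    using flow_cons[OF lt(5), of ds] by (simp_all add: I_def U_def)
  show ?thesis
    using assms(2) lt(1-4) fresh
    unfolding flow_def vertical_twist_def Let_def x_def[symmetric]
    by (cases p1; cases p2; cases p3; cases p4)
      (auto simp: I_def[symmetric] U_def[symmetric] simp del: set_concat)
qed

text \<open>The two strands of a tangle connect its corners in one of three ways.\<close>

definition orientable :: "tangle \<Rightarrow> bool" where
  "orientable T \<longleftrightarrow> bounded_labels T \<and>
     ((\<forall>p q. \<exists>ds. flow T p (\<not> p) q (\<not> q) ds) \<or>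
      (\<forall>p q. \<exists>ds. flow T p q (\<not> p) (\<not> q) ds) \<or>
      (\<forall>p q. \<exists>ds. flow T p q (\<not> q) (\<not> p) ds))"

lemma orientable_horizontal:
  assumes "orientable T"
  shows "orientable (horizontal_twist T)"
proof -
  have b: "bounded_labels T"
    using assms by (simp add: orientable_def)
  have "\<exists>ds. flow (horizontal_twist T) p1 p4 p3 p2 ds" if "\<exists>ds. flow T p1 p2 p3 p4 ds" for p1 p2 p3 p4
    using that flow_horizontal[OF b] by blast
  then show ?thesis
    using assms bounded_labels_twist(1)[OF b] unfolding orientable_def all_bool_eq
    by (simp only: simp_thms) blast
qed

lemma orientable_vertical:
  assumes "orientable T"
  shows "orientable (vertical_twist T)"
proof -
  have b: "bounded_labels T"
    using assms by (simp add: orientable_def)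
  have "\<exists>ds. flow (vertical_twist T) p1 p2 p4 p3 ds" if "\<exists>ds. flow T p1 p2 p3 p4 ds" for p1 p2 p3 p4
    using that flow_vertical[OF b] by blast
  then show ?thesis
    using assms bounded_labels_twist(2)[OF b] unfolding orientable_def all_bool_eq
    by (simp only: simp_thms) blast
qed

lemma orientable_rational_tangle: "orientable (rational_tangle hor as)"
proof (induction as arbitrary: hor)
  case Nil
  show ?case
    by (auto simp: orientable_def bounded_labels_def labels_def flow_def
        infinity_tangle_def zero_tangle_def)
next
  case (Cons a as)
  have "orientable ((f ^^ a) T)" if "\<And>T. orientable T \<Longrightarrow> orientable (f T)" "orientable T" for f T
    using that by (induction a) auto
  then show ?case
    using Cons orientable_horizontal orientable_vertical by simp
qed

lemma rational_link_orientable: "\<exists>ds. is_orientation (rational_link \<alpha>) ds"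
proof -
  obtain r s where rs: "quotient_of \<alpha> = (r, s)"
    by fastforce
  define T where "T = rational_tangle True (cfrac (nat r) (nat s))"
  have "orientable T"
    by (simp add: T_def orientable_rational_tangle)
  then have "\<exists>p q ds. flow T p (\<not> p) q (\<not> q) ds"
    unfolding orientable_def all_bool_eq ex_bool_eq by (simp only: simp_thms) blast
  then obtain p q ds where fl: "flow T p (\<not> p) q (\<not> q) ds"
    by blast
  have "is_orientation (numerator_closure T) ((p, True) # (q, True) # ds)"
    using fl unfolding flow_def is_orientation_def numerator_closure_def
    by (cases p; cases q) auto
  then show ?thesis
    using rs by (auto simp: rational_link_def T_def)
qed

end

theory Submission
  imports Defs
begin

text \<open>
  At \<open>q = \<i>\<close> the normalized Jones polynomial is a Gaussian integer, and its absolute value is that of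
  the Kauffman bracket at a primitive 16th root of unity \<open>A\<close>. A twist acts linearly on the pair
  \<open>(N, D)\<close> of the brackets of the numerator and the denominator closure of a tangle. For a tangle of
  fraction \<open>p / q\<close>, the absolute values of \<open>N\<close> and \<open>D\<close> and the product \<open>A\<^sup>2 N\<close> times the conjugate
  of \<open>D\<close> depend at \<open>A\<close> only on \<open>p\<close>, \<open>q\<close> and \<open>p q\<close> modulo 4, through one and the same function.
\<close>

section \<open>Connected components\<close>

definition conn :: "(nat \<times> nat) set \<Rightarrow> nat \<Rightarrow> nat \<Rightarrow> bool" where
  "conn G u v \<longleftrightarrow> (u, v) \<in> (G \<union> G\<inverse>)\<^sup>*"

lemma conn_refl [simp]: "conn G u u"
  by (simp add: conn_def)

lemma conn_sym: "conn G u v \<Longrightarrow> conn G v u"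
  unfolding conn_def by (meson sym_Un_converse sym_rtrancl symD)

lemma conn_commute: "conn G u v \<longleftrightarrow> conn G v u"
  using conn_sym by blast

lemma conn_trans: "conn G u v \<Longrightarrow> conn G v w \<Longrightarrow> conn G u w"
  unfolding conn_def by (rule rtrancl_trans)

lemma conn_empty [simp]: "conn {} u v \<longleftrightarrow> u = v"
  by (simp add: conn_def)

lemma conn_insert:
  "conn (insert (a, b) G) u v \<longleftrightarrow>
     conn G u v \<or> (conn G u a \<and> conn G b v) \<or> (conn G u b \<and> conn G a v)"
proof -
  have symcl: "insert (a, b) G \<union> (insert (a, b) G)\<inverse> = insert (a, b) (insert (b, a) (G \<union> G\<inverse>))"
    by auto
  show ?thesis
    unfolding conn_def symcl rtrancl_insert
    by (simp flip: conn_def) (meson conn_refl conn_sym conn_trans)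
qed

lemma conn_outside:
  assumes "G \<subseteq> L \<times> L" and "x \<notin> L"
  shows "conn G x v \<longleftrightarrow> v = x" and "conn G v x \<longleftrightarrow> v = x"
proof -
  have "v = x" if "(x, v) \<in> (G \<union> G\<inverse>)\<^sup>*" for v
    using that by (induction rule: rtrancl_induct) (use assms in auto)
  then show "conn G x v \<longleftrightarrow> v = x"
    by (auto simp: conn_def)
  then show "conn G v x \<longleftrightarrow> v = x"
    using conn_commute by blast
qed

definition component :: "(nat \<times> nat) set \<Rightarrow> nat \<Rightarrow> nat set" where
  "component G v = {w. conn G v w}"

lemma component_eq_iff: "component G u = component G v \<longleftrightarrow> conn G u v"
  unfolding component_def by (metis Collect_cong conn_refl conn_sym conn_trans mem_Collect_eq)

lemma loops_eq_card_components: "loops L G = card (component G ` L)"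
  by (simp add: loops_def component_def conn_def Image_def)

lemma loops_cong:
  assumes "\<And>u v. u \<in> L \<Longrightarrow> v \<in> L \<Longrightarrow> conn G u v \<longleftrightarrow> conn H u v"
  shows "loops L G = loops L H"
proof -
  have "bij_betw (\<lambda>S. component H (inv_into L (component G) S)) (component G ` L) (component H ` L)"
    (is "bij_betw ?f _ _")
  proof (rule bij_betw_imageI)
    have f: "?f (component G v) = component H v" if "v \<in> L" for v
      using that assms f_inv_into_f[of "component G v" "component G" L]
      by (metis component_eq_iff imageI inv_into_into)
    then show "?f ` component G ` L = component H ` L"
      by (simp add: image_image)
    show "inj_on ?f (component G ` L)"
      by (intro inj_onI; elim imageE) (metis assms component_eq_iff f)
  qed
  then show ?thesis
    unfolding loops_eq_card_components by (rule bij_betw_same_card)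
qed

lemma loops_insert_connected:
  assumes "conn G a b"
  shows "loops L (insert (a, b) G) = loops L G"
  by (rule loops_cong) (metis assms conn_insert conn_sym conn_trans)

lemma loops_insert_connected_vertex:
  assumes "conn G x a" and "a \<in> L"
  shows "loops (insert x L) G = loops L G"
proof -
  have "component G x = component G a"
    using assms(1) by (simp add: component_eq_iff)
  then show ?thesis
    using assms(2) by (simp add: loops_eq_card_components insert_absorb)
qed

lemma loops_insert_isolated_vertex:
  assumes "G \<subseteq> L \<times> L" and "x \<notin> L" and "finite L"
  shows "loops (insert x L) G = Suc (loops L G)"
proof -
  have "component G x \<notin> component G ` L"
    unfolding image_iff component_eq_iff using assms(2) conn_outside[OF assms(1,2)] by auto
  then show ?thesis
    using assms(3) by (simp add: loops_eq_card_components)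
qed

lemma loops_subdivide:
  assumes G: "G \<subseteq> L \<times> L" and "a \<in> L" "b \<in> L" and x: "x \<notin> L"
  shows "loops (insert x L) (insert (a, x) (insert (x, b) G)) = loops L (insert (a, b) G)"
proof -
  let ?H = "insert (a, x) (insert (x, b) G)"
  have "conn ?H x a"
    by (simp add: conn_insert)
  then have "loops (insert x L) ?H = loops L ?H"
    using \<open>a \<in> L\<close> by (rule loops_insert_connected_vertex)
  also have "\<dots> = loops L (insert (a, b) G)"
    by (rule loops_cong) (use assms conn_outside[OF G x] in \<open>auto simp: conn_insert\<close>)
  finally show ?thesis .
qed

lemma loops_circle:
  assumes "G \<subseteq> L \<times> L" and "x \<notin> L" "y \<notin> L" "x \<noteq> y" and "finite L"
  shows "loops (insert y (insert x L)) (insert (x, y) G) = Suc (loops L G)"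
proof -
  have "loops (insert y (insert x L)) (insert (x, y) G) =
      loops (insert y (insert x L)) (insert (y, x) (insert (x, y) G))"
    by (rule loops_insert_connected[symmetric]) (simp add: conn_insert)
  also have "\<dots> = loops (insert y (insert x L)) (insert (x, y) (insert (y, x) G))"
    by (simp add: insert_commute)
  also have "\<dots> = loops (insert x L) (insert (x, x) G)"
    using assms by (intro loops_subdivide) auto
  also have "\<dots> = loops (insert x L) G"
    by (rule loops_insert_connected) simp
  also have "\<dots> = Suc (loops L G)"
    using assms by (intro loops_insert_isolated_vertex)
  finally show ?thesis .
qed

lemma loops_two_vertices:
  assumes "a \<noteq> b"
  shows "loops {a, b} {(a, a), (b, b)} = 2" and "loops {a, b} {(a, b)} = 1"
  using assms by (auto simp: loops_eq_card_components component_eq_iff conn_insert card_insert_if)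

section \<open>Laurent polynomials\<close>

definition laurent_eval :: "'a :: field \<Rightarrow> laurent \<Rightarrow> 'a" where
  "laurent_eval z p = (\<Sum>k\<in>Poly_Mapping.keys p. of_int (Poly_Mapping.lookup p k) * z powi k)"

lemma laurent_eval_0 [simp]: "laurent_eval z 0 = 0"
  by (simp add: laurent_eval_def)

lemma laurent_eval_single [simp]:
  "laurent_eval z (Poly_Mapping.single k c) = of_int c * z powi k"
  by (simp add: laurent_eval_def)

lemma laurent_eval_1 [simp]: "laurent_eval z 1 = 1"
  by (simp flip: single_one)

lemma laurent_eval_add: "laurent_eval z (p + q) = laurent_eval z p + laurent_eval z q"
  unfolding laurent_eval_def
  by (rule setsum_keys_plus_distrib[where f = "\<lambda>k c. of_int c * z powi k"]) (auto simp: algebra_simps)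

lemma laurent_eval_uminus: "laurent_eval z (- p) = - laurent_eval z p"
  using laurent_eval_add[of z p "- p"] by (simp add: eq_neg_iff_add_eq_0 add.commute)

lemma laurent_eval_diff: "laurent_eval z (p - q) = laurent_eval z p - laurent_eval z q"
  using laurent_eval_add[of z p "- q"] by (simp add: laurent_eval_uminus)

lemma laurent_eval_mult:
  assumes "z \<noteq> 0"
  shows "laurent_eval z (p * q) = laurent_eval z p * laurent_eval z q"
proof (induction p rule: frag_induction[OF subset_UNIV])
  case (2 k)
  show ?case
    by (induction q rule: frag_induction[OF subset_UNIV])
      (use assms in \<open>simp_all add: mult_single power_int_add laurent_eval_diff right_diff_distrib\<close>)
qed (simp_all add: laurent_eval_diff left_diff_distrib)

lemma laurent_eval_map_key:
  assumes "m \<noteq> 0" and dvd: "\<And>k. k \<in> Poly_Mapping.keys p \<Longrightarrow> m dvd k"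
  shows "laurent_eval (z powi m) (Poly_Mapping.map_key ((*) m) p) = laurent_eval z p"
proof -
  have inj: "inj ((*) m)"
    using assms(1) by (simp add: inj_def)
  let ?K = "Poly_Mapping.keys (Poly_Mapping.map_key ((*) m) p)"
  have lookup: "Poly_Mapping.lookup (Poly_Mapping.map_key ((*) m) p) n = Poly_Mapping.lookup p (m * n)"
    for n by (simp add: map_key.rep_eq[OF inj])
  have "Poly_Mapping.keys p = (*) m ` ?K"
    using dvd by (fastforce simp: in_keys_iff lookup dvd_def)
  moreover have "inj_on ((*) m) ?K"
    using inj by (rule inj_on_subset) simp
  ultimately show ?thesis
    by (simp add: laurent_eval_def sum.reindex lookup power_int_mult)
qed

definition homogeneous_mod :: "int \<Rightarrow> int \<Rightarrow> laurent \<Rightarrow> bool" where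
  "homogeneous_mod m e p \<longleftrightarrow> (\<forall>k\<in>Poly_Mapping.keys p. [k = e] (mod m))"

lemma homogeneous_mod_cong:
  "homogeneous_mod m e p \<Longrightarrow> [e = f] (mod m) \<Longrightarrow> homogeneous_mod m f p"
  unfolding homogeneous_mod_def using cong_trans by blast

lemma homogeneous_mod_single: "homogeneous_mod m k (Poly_Mapping.single k c)"
  by (simp add: homogeneous_mod_def)

lemma homogeneous_mod_uminus: "homogeneous_mod m e p \<Longrightarrow> homogeneous_mod m e (- p)"
  by (simp add: homogeneous_mod_def)

lemma homogeneous_mod_add:
  "homogeneous_mod m e p \<Longrightarrow> homogeneous_mod m e q \<Longrightarrow> homogeneous_mod m e (p + q)"
  unfolding homogeneous_mod_def using Poly_Mapping.keys_add[of p q] by blast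

lemma homogeneous_mod_mult:
  "homogeneous_mod m e p \<Longrightarrow> homogeneous_mod m f q \<Longrightarrow> homogeneous_mod m (e + f) (p * q)"
  unfolding homogeneous_mod_def using keys_mult[of p q] by (fastforce intro: cong_add)

lemma homogeneous_mod_monomial_mult:
  "homogeneous_mod m e p \<Longrightarrow> homogeneous_mod m (k + e) (Poly_Mapping.single k c * p)"
  by (rule homogeneous_mod_mult[OF homogeneous_mod_single])

lemma homogeneous_mod_power:
  "homogeneous_mod m e p \<Longrightarrow> homogeneous_mod m (int n * e) (p ^ n)"
proof (induction n)
  case 0
  show ?case
    by (simp add: homogeneous_mod_def)
next
  case (Suc n)
  then show ?case
    using homogeneous_mod_mult[of m e p "int n * e" "p ^ n"] by (simp add: algebra_simps)
qed

lemma homogeneous_mod_sum_list: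
  "(\<And>x. x \<in> set xs \<Longrightarrow> homogeneous_mod m e (f x)) \<Longrightarrow> homogeneous_mod m e (\<Sum>x\<leftarrow>xs. f x)"
  by (induction xs) (auto intro: homogeneous_mod_add simp: homogeneous_mod_def[of _ _ 0])

lemma homogeneous_mod_loop_value:
  assumes "m dvd 4"
  shows "homogeneous_mod m 2 loop_value"
proof -
  have "homogeneous_mod m 2 (Poly_Mapping.single (-2) 1)"
    using assms by (intro homogeneous_mod_cong[OF homogeneous_mod_single]) (simp add: cong_iff_dvd_diff)
  then show ?thesis
    unfolding loop_value_def diff_conv_add_uminus
    by (intro homogeneous_mod_add homogeneous_mod_uminus homogeneous_mod_single)
qed

section \<open>The normalized Jones polynomial on the unit circle\<close>

lemma even_state_writhe:
  assumes "length ds = length D" and "(k, G) \<in> set (states D)"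
  shows "even (k + writhe D ds)"
  using assms
proof (induction D arbitrary: ds k G)
  case Nil
  then show ?case
    by (simp add: writhe_def)
next
  case (Cons x D)
  then obtain u v ds' where ds: "ds = (u, v) # ds'" "length ds' = length D"
    by (cases ds) auto
  then have "writhe (x # D) ds = node_sign x (u, v) + writhe D ds'"
    by (simp add: writhe_def)
  then show ?case
    using Cons.prems(2) Cons.IH[OF ds(2)] by (cases x) (fastforce split: if_splits)+
qed

lemma homogeneous_bracket_writhe:
  assumes "length ds = length D"
  shows "homogeneous_mod 2 (writhe D ds) (bracket D)"
  unfolding bracket_def
proof (rule homogeneous_mod_sum_list, clarify)
  fix k G assume "(k, G) \<in> set (states D)"
  then have "even (k + writhe D ds)"
    using even_state_writhe[OF assms] by blast
  then have "[k + int n * 2 = writhe D ds] (mod 2)" for n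
    unfolding cong_iff_dvd_diff by presburger
  moreover have "homogeneous_mod 2 (k + int n * 2) (Poly_Mapping.single k 1 * loop_value ^ n)" for n
    by (intro homogeneous_mod_monomial_mult homogeneous_mod_power homogeneous_mod_loop_value) simp
  ultimately show "homogeneous_mod 2 (writhe D ds)
      (Poly_Mapping.single k 1 * loop_value ^ (loops (labels D) G - 1))"
    using homogeneous_mod_cong by blast
qed

definition normalized_bracket :: "diagram \<Rightarrow> direction list \<Rightarrow> laurent" where
  "normalized_bracket D ds =
     Poly_Mapping.single (- 3 * writhe D ds) ((-1) ^ nat \<bar>writhe D ds\<bar>) * bracket D"

lemma homogeneous_normalized_bracket:
  "homogeneous_mod m e (bracket D) \<Longrightarrow>
     homogeneous_mod m (- 3 * writhe D ds + e) (normalized_bracket D ds)"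
  unfolding normalized_bracket_def by (rule homogeneous_mod_monomial_mult)

lemma jones_eq_map_key: "jones D ds = Poly_Mapping.map_key ((*) (- 2)) (normalized_bracket D ds)"
  by (simp only: jones_def normalized_bracket_def)

lemma cmod_jones:
  assumes A: "cmod A = 1" and "length ds = length D"
  shows "cmod (laurent_eval (A powi (- 2)) (jones D ds)) = cmod (laurent_eval A (bracket D))"
proof -
  have "- 2 dvd k" if "k \<in> Poly_Mapping.keys (normalized_bracket D ds)" for k
    using homogeneous_normalized_bracket[OF homogeneous_bracket_writhe[OF assms(2)]] that
    unfolding homogeneous_mod_def cong_iff_dvd_diff by fastforce
  then have "laurent_eval (A powi (- 2)) (jones D ds) = laurent_eval A (normalized_bracket D ds)"
    unfolding jones_eq_map_key by - (rule laurent_eval_map_key, simp)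
  moreover have "A \<noteq> 0"
    using A by auto
  ultimately show ?thesis
    by (simp add: normalized_bracket_def laurent_eval_mult norm_mult norm_power norm_power_int A)
qed

lemma homogeneous_jones:
  assumes "homogeneous_mod 4 e (bracket D)"
  shows "homogeneous_mod 2 ((3 * writhe D ds - e) div 2) (jones D ds)"
  unfolding homogeneous_mod_def
proof
  fix n assume "n \<in> Poly_Mapping.keys (jones D ds)"
  moreover have "inj ((*) (- 2 :: int))"
    by (simp add: inj_def)
  ultimately have "- 2 * n \<in> Poly_Mapping.keys (normalized_bracket D ds)"
    unfolding jones_eq_map_key in_keys_iff by (simp add: map_key.rep_eq)
  then have "4 dvd - 2 * n - (- 3 * writhe D ds + e)"
    using homogeneous_normalized_bracket[OF assms]
    unfolding homogeneous_mod_def cong_iff_dvd_diff by blast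
  then show "[n = (3 * writhe D ds - e) div 2] (mod 2)"
    unfolding cong_iff_dvd_diff by presburger
qed

lemma cmod_normalized_jones_eq_cmod_jones:
  assumes z: "cmod z = 1" and hom: "homogeneous_mod 2 e (jones D ds)"
  shows "cmod (normalized_jones D ds (- inverse (z\<^sup>2))) = cmod (laurent_eval z (jones D ds))"
proof (cases "jones D ds = 0")
  case True
  then show ?thesis
    by (simp add: normalized_jones_def)
next
  case False
  define V where "V = jones D ds"
  define m where "m = Max (Poly_Mapping.keys V)"
  have m: "m \<in> Poly_Mapping.keys V"
    using False by (simp add: m_def V_def)
  have "z\<^sup>2 powi ((n - m) div 2) = z powi n * z powi (- m)" if "n \<in> Poly_Mapping.keys V" for n
  proof -
    have "even (n - m)"
      using hom that m unfolding homogeneous_mod_def V_def cong_def by (metis mod_eq_dvd_iff)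
    then have "z\<^sup>2 powi ((n - m) div 2) = z powi (n - m)"
      using power_int_mult[of z 2 "(n - m) div 2"] by simp
    then show ?thesis
      using z power_int_add[of z n "- m"] by force
  qed
  then have "normalized_jones D ds (- inverse (z\<^sup>2)) =
      of_int (sgn (Poly_Mapping.lookup V m)) * (laurent_eval z V * z powi (- m))"
    by (simp add: normalized_jones_def laurent_eval_def Let_def sum_distrib_right mult.assoc
        flip: V_def m_def)
  moreover have "Poly_Mapping.lookup V m \<noteq> 0"
    using m by (simp add: in_keys_iff)
  ultimately show ?thesis
    using z by (simp add: V_def norm_mult norm_power_int sgn_if)
qed

text \<open>Here \<open>q = - A\<^sup>4\<close>, since the bracket is evaluated at \<open>t = A\<^sup>-\<^sup>4\<close> and \<open>t = - q\<^sup>-\<^sup>1\<close>.\<close>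

proposition cmod_normalized_jones:
  assumes A: "cmod A = 1" and "homogeneous_mod 4 e (bracket D)" and "length ds = length D"
  shows "cmod (normalized_jones D ds (- (A ^ 4))) = cmod (laurent_eval A (bracket D))"
proof -
  have "A ^ 4 = inverse ((A powi (- 2))\<^sup>2)"
    by (simp add: power_int_minus power_inverse flip: power_mult)
  moreover have "cmod (A powi (- 2)) = 1"
    by (simp add: A norm_power_int)
  ultimately have "cmod (normalized_jones D ds (- (A ^ 4))) =
      cmod (laurent_eval (A powi (- 2)) (jones D ds))"
    using cmod_normalized_jones_eq_cmod_jones homogeneous_jones[OF assms(2)] by metis
  also have "\<dots> = cmod (laurent_eval A (bracket D))"
    using A assms(3) by (rule cmod_jones)
  finally show ?thesis .
qed

section \<open>Brackets of tangle closures\<close>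

lemma states_subset: "(k, G) \<in> set (states D) \<Longrightarrow> G \<subseteq> labels D \<times> labels D"
  by (induction D arbitrary: k G rule: states.induct) (fastforce simp: labels_def)+

definition state_sum :: "nat set \<Rightarrow> diagram \<Rightarrow> (nat \<times> nat) set \<Rightarrow> laurent" where
  "state_sum L D C =
     (\<Sum>(k, G)\<leftarrow>states D. Poly_Mapping.single k 1 * loop_value ^ (loops L (C \<union> G) - 1))"

lemma bracket_eq_state_sum: "bracket D = state_sum (labels D) D {}"
  by (simp add: bracket_def state_sum_def)

lemma state_sum_Nil: "state_sum L [] C = loop_value ^ (loops L C - 1)"
  by (simp add: state_sum_def)

lemma state_sum_Join: "state_sum L (Join a b # D) C = state_sum L D (insert (a, b) C)"
  by (simp add: state_sum_def o_def case_prod_unfold)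

lemma state_sum_Cross:
  "state_sum L (Cross a b c d # D) C =
     Poly_Mapping.single 1 1 * state_sum L D ({(a, b), (c, d)} \<union> C) +
     Poly_Mapping.single (-1) 1 * state_sum L D ({(a, d), (b, c)} \<union> C)"
  by (simp add: state_sum_def o_def case_prod_unfold mult_single mult.assoc[symmetric] add.commute[of 1]
      flip: sum_list_const_mult)

lemma state_sum_symcl_cong:
  assumes "C \<union> C\<inverse> = C' \<union> C'\<inverse>"
  shows "state_sum L D C = state_sum L D C'"
proof -
  have "(C \<union> G) \<union> (C \<union> G)\<inverse> = (C' \<union> G) \<union> (C' \<union> G)\<inverse>" for G
    using assms by blast
  then show ?thesis
    by (simp add: state_sum_def loops_def)
qed

lemma state_sum_Cross_symcl:
  assumes "({(a, b), (c, d)} \<union> C) \<union> ({(a, b), (c, d)} \<union> C)\<inverse> = C\<^sub>A \<union> C\<^sub>A\<inverse>"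
    and "({(a, d), (b, c)} \<union> C) \<union> ({(a, d), (b, c)} \<union> C)\<inverse> = C\<^sub>B \<union> C\<^sub>B\<inverse>"
  shows "state_sum L (Cross a b c d # D) C =
    Poly_Mapping.single 1 1 * state_sum L D C\<^sub>A + Poly_Mapping.single (-1) 1 * state_sum L D C\<^sub>B"
  unfolding state_sum_Cross state_sum_symcl_cong[OF assms(1)] state_sum_symcl_cong[OF assms(2)] ..

lemma state_sum_subdivide:
  assumes "labels D \<subseteq> L" and "C \<subseteq> L \<times> L" and "a \<in> L" "b \<in> L" and "x \<notin> L"
  shows "state_sum (insert x L) D (insert (a, x) (insert (x, b) C)) = state_sum L D (insert (a, b) C)"
proof -
  have "loops (insert x L) (insert (a, x) (insert (x, b) (C \<union> G))) = loops L (insert (a, b) (C \<union> G))"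
    if "(k, G) \<in> set (states D)" for k G
    using states_subset[OF that] assms by (intro loops_subdivide) auto
  then show ?thesis
    unfolding state_sum_def by (auto intro!: arg_cong[of _ _ sum_list])
qed

lemma state_sum_circle:
  assumes "labels D \<subseteq> L" and "C \<subseteq> L \<times> L" and "x \<notin> L" "y \<notin> L" "x \<noteq> y"
    and "finite L" "L \<noteq> {}"
  shows "state_sum (insert y (insert x L)) D (insert (x, y) C) = loop_value * state_sum L D C"
proof -
  have "loop_value ^ (loops (insert y (insert x L)) (insert (x, y) (C \<union> G)) - 1) =
      loop_value * loop_value ^ (loops L (C \<union> G) - 1)"
    if "(k, G) \<in> set (states D)" for k G
  proof -
    have "loops (insert y (insert x L)) (insert (x, y) (C \<union> G)) = Suc (loops L (C \<union> G))"
      using states_subset[OF that] assms by (intro loops_circle) auto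
    moreover have "0 < loops L (C \<union> G)"
      using assms(6,7) by (simp add: loops_def card_gt_0_iff)
    ultimately show ?thesis
      by (simp flip: power_Suc)
  qed
  then show ?thesis
    unfolding state_sum_def sum_list_const_mult[symmetric]
    by (auto intro!: arg_cong[of _ _ sum_list] simp: mult.left_commute)
qed

lemma state_sum_subdivide_twice:
  assumes "labels D \<subseteq> L" and "C \<subseteq> L \<times> L" and "a \<in> L" "b \<in> L"
    and "x \<notin> L" "y \<notin> L" "x \<noteq> y"
  shows "state_sum (insert y (insert x L)) D ({(a, x), (x, y), (y, b)} \<union> C) =
    state_sum L D (insert (a, b) C)"
proof -
  have "state_sum (insert y (insert x L)) D ({(a, x), (x, y), (y, b)} \<union> C) =
      state_sum (insert y (insert x L)) D (insert (x, y) (insert (y, b) (insert (a, x) C)))"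
    by (simp add: insert_commute)
  also have "\<dots> = state_sum (insert x L) D (insert (x, b) (insert (a, x) C))"
    using assms by (intro state_sum_subdivide) auto
  also have "\<dots> = state_sum (insert x L) D (insert (a, x) (insert (x, b) C))"
    by (simp add: insert_commute)
  also have "\<dots> = state_sum L D (insert (a, b) C)"
    using assms by (intro state_sum_subdivide)
  finally show ?thesis .
qed

lemma loop_value_twist:
  "Poly_Mapping.single 1 1 * loop_value + Poly_Mapping.single (-1) 1 = - Poly_Mapping.single 3 1"
  "Poly_Mapping.single 1 1 + Poly_Mapping.single (-1) 1 * loop_value = - Poly_Mapping.single (-3) 1"
  by (simp_all add: loop_value_def mult_single right_diff_distrib)

text \<open>
  A crossing attached to the ends \<open>b\<close> and \<open>d\<close> of a tangle with ends \<open>a, b, c, d\<close> has new ends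
  \<open>x\<close> and \<open>y\<close>. One smoothing prolongs \<open>b\<close> to \<open>x\<close> and \<open>d\<close> to \<open>y\<close>, the other one joins \<open>b\<close> to \<open>d\<close>
  and \<open>x\<close> to \<open>y\<close>. The outer arcs either join \<open>a\<close> to \<open>x\<close> and \<open>c\<close> to \<open>y\<close>, or \<open>a\<close> to \<open>c\<close> and \<open>x\<close> to \<open>y\<close>.
\<close>

locale attached_crossing =
  fixes L :: "nat set" and D :: diagram and a b c d x y :: nat
  assumes labels_subset: "labels D \<subseteq> L" and finite_L: "finite L"
    and ends: "a \<in> L" "b \<in> L" "c \<in> L" "d \<in> L"
    and fresh: "x \<notin> L" "y \<notin> L" "x \<noteq> y"
begin

abbreviation L' :: "nat set" where
  "L' \<equiv> insert y (insert x L)"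

lemma prolonged_across: "state_sum L' D {(a, x), (c, y), (b, x), (d, y)} = state_sum L D {(a, b), (c, d)}"
proof -
  have "state_sum L' D {(a, x), (c, y), (b, x), (d, y)} =
      state_sum L' D {(c, y), (y, d), (a, x), (x, b)}"
    by (rule state_sum_symcl_cong) auto
  also have "\<dots> = state_sum (insert x L) D {(c, d), (a, x), (x, b)}"
    using labels_subset ends fresh by (intro state_sum_subdivide) auto
  also have "\<dots> = state_sum (insert x L) D {(a, x), (x, b), (c, d)}"
    by (simp add: insert_commute)
  also have "\<dots> = state_sum L D {(a, b), (c, d)}"
    using labels_subset ends fresh by (intro state_sum_subdivide) auto
  finally show ?thesis .
qed

lemma joined_across: "state_sum L' D {(a, x), (c, y), (b, d), (x, y)} = state_sum L D {(a, c), (b, d)}"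
proof -
  have "state_sum L' D {(a, x), (c, y), (b, d), (x, y)} =
      state_sum L' D ({(a, x), (x, y), (y, c)} \<union> {(b, d)})"
    by (rule state_sum_symcl_cong) auto
  also have "\<dots> = state_sum L D {(a, c), (b, d)}"
    using labels_subset ends fresh by (intro state_sum_subdivide_twice) auto
  finally show ?thesis .
qed

lemma prolonged_capped: "state_sum L' D {(a, c), (x, y), (b, x), (d, y)} = state_sum L D {(a, c), (b, d)}"
proof -
  have "state_sum L' D {(a, c), (x, y), (b, x), (d, y)} =
      state_sum L' D ({(b, x), (x, y), (y, d)} \<union> {(a, c)})"
    by (rule state_sum_symcl_cong) auto
  also have "\<dots> = state_sum L D {(b, d), (a, c)}"
    using labels_subset ends fresh by (intro state_sum_subdivide_twice) auto
  finally show ?thesis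
    by (simp add: insert_commute)
qed

lemma joined_capped:
  "state_sum L' D {(a, c), (x, y), (b, d)} = loop_value * state_sum L D {(a, c), (b, d)}"
proof -
  have "state_sum L' D {(a, c), (x, y), (b, d)} = state_sum L' D {(x, y), (a, c), (b, d)}"
    by (simp add: insert_commute)
  also have "\<dots> = loop_value * state_sum L D {(a, c), (b, d)}"
    using labels_subset finite_L ends fresh by (intro state_sum_circle) auto
  finally show ?thesis .
qed

lemma horizontal_crossing_across:
  "state_sum L' (Cross y x b d # D) {(a, x), (c, y)} =
     Poly_Mapping.single 1 1 * state_sum L D {(a, c), (b, d)} +
     Poly_Mapping.single (-1) 1 * state_sum L D {(a, b), (c, d)}"
  unfolding joined_across[symmetric] prolonged_across[symmetric]
  by (rule state_sum_Cross_symcl) auto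

lemma horizontal_crossing_capped:
  "state_sum L' (Cross y x b d # D) {(a, c), (x, y)} =
     - Poly_Mapping.single 3 1 * state_sum L D {(a, c), (b, d)}"
proof -
  have "state_sum L' (Cross y x b d # D) {(a, c), (x, y)} =
      Poly_Mapping.single 1 1 * state_sum L' D {(a, c), (x, y), (b, d)} +
      Poly_Mapping.single (-1) 1 * state_sum L' D {(a, c), (x, y), (b, x), (d, y)}"
    by (rule state_sum_Cross_symcl) auto
  then show ?thesis
    by (simp add: joined_capped prolonged_capped distrib_right mult.assoc flip: loop_value_twist(1))
qed

lemma vertical_crossing_across:
  "state_sum L' (Cross y d b x # D) {(a, x), (c, y)} =
     Poly_Mapping.single 1 1 * state_sum L D {(a, b), (c, d)} +
     Poly_Mapping.single (-1) 1 * state_sum L D {(a, c), (b, d)}"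
  unfolding joined_across[symmetric] prolonged_across[symmetric]
  by (rule state_sum_Cross_symcl) auto

lemma vertical_crossing_capped:
  "state_sum L' (Cross y d b x # D) {(a, c), (x, y)} =
     - Poly_Mapping.single (-3) 1 * state_sum L D {(a, c), (b, d)}"
proof -
  have "state_sum L' (Cross y d b x # D) {(a, c), (x, y)} =
      Poly_Mapping.single 1 1 * state_sum L' D {(a, c), (x, y), (b, x), (d, y)} +
      Poly_Mapping.single (-1) 1 * state_sum L' D {(a, c), (x, y), (b, d)}"
    by (rule state_sum_Cross_symcl) auto
  then show ?thesis
    by (simp add: joined_capped prolonged_capped distrib_right mult.assoc flip: loop_value_twist(2))
qed

end

definition tangle_labels :: "tangle \<Rightarrow> nat set" where
  "tangle_labels T = {nw T, ne T, sw T, se T} \<union> labels (nodes T)"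

lemma tangle_labels_bounded: "bounded_labels T \<Longrightarrow> tangle_labels T \<subseteq> {..<2 * length (nodes T) + 2}"
  by (simp add: bounded_labels_def tangle_labels_def)

definition numerator_bracket :: "tangle \<Rightarrow> laurent" where
  "numerator_bracket T = state_sum (tangle_labels T) (nodes T) {(nw T, ne T), (sw T, se T)}"

definition denominator_bracket :: "tangle \<Rightarrow> laurent" where
  "denominator_bracket T = state_sum (tangle_labels T) (nodes T) {(nw T, sw T), (ne T, se T)}"

lemma bracket_numerator_closure: "bracket (numerator_closure T) = numerator_bracket T"
proof -
  have "labels (numerator_closure T) = tangle_labels T"
    by (auto simp: labels_def numerator_closure_def tangle_labels_def)
  then show ?thesis
    by (simp add: bracket_eq_state_sum numerator_bracket_def numerator_closure_def state_sum_Join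
        insert_commute)
qed

lemma horizontal_twist_brackets:
  assumes "bounded_labels T"
  shows "numerator_bracket (horizontal_twist T) =
      Poly_Mapping.single 1 1 * denominator_bracket T + Poly_Mapping.single (-1) 1 * numerator_bracket T"
    and "denominator_bracket (horizontal_twist T) = - Poly_Mapping.single 3 1 * denominator_bracket T"
proof -
  define x where "x = 2 * length (nodes T) + 2"
  have twist: "nodes (horizontal_twist T) = Cross (Suc x) x (ne T) (se T) # nodes T"
    "nw (horizontal_twist T) = nw T" "ne (horizontal_twist T) = x"
    "sw (horizontal_twist T) = sw T" "se (horizontal_twist T) = Suc x"
    by (simp_all add: horizontal_twist_def Let_def x_def)
  have twist_labels: "tangle_labels (horizontal_twist T) = insert (Suc x) (insert x (tangle_labels T))"
    by (auto simp: twist tangle_labels_def labels_def)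
  interpret attached_crossing "tangle_labels T" "nodes T" "nw T" "ne T" "sw T" "se T" x "Suc x"
    using tangle_labels_bounded[OF assms]
    by unfold_locales (auto simp: tangle_labels_def x_def intro: finite_subset)
  show "numerator_bracket (horizontal_twist T) =
      Poly_Mapping.single 1 1 * denominator_bracket T + Poly_Mapping.single (-1) 1 * numerator_bracket T"
    using horizontal_crossing_across
    unfolding numerator_bracket_def denominator_bracket_def twist_labels twist by simp
  show "denominator_bracket (horizontal_twist T) = - Poly_Mapping.single 3 1 * denominator_bracket T"
    using horizontal_crossing_capped unfolding denominator_bracket_def twist_labels twist by simp
qed

lemma vertical_twist_brackets:
  assumes "bounded_labels T"
  shows "numerator_bracket (vertical_twist T) = - Poly_Mapping.single (-3) 1 * numerator_bracket T"
    and "denominator_bracket (vertical_twist T) =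
      Poly_Mapping.single 1 1 * denominator_bracket T + Poly_Mapping.single (-1) 1 * numerator_bracket T"
proof -
  define x where "x = 2 * length (nodes T) + 2"
  have twist: "nodes (vertical_twist T) = Cross (Suc x) (se T) (sw T) x # nodes T"
    "nw (vertical_twist T) = nw T" "ne (vertical_twist T) = ne T"
    "sw (vertical_twist T) = x" "se (vertical_twist T) = Suc x"
    by (simp_all add: vertical_twist_def Let_def x_def)
  have twist_labels: "tangle_labels (vertical_twist T) = insert (Suc x) (insert x (tangle_labels T))"
    by (auto simp: twist tangle_labels_def labels_def)
  interpret attached_crossing "tangle_labels T" "nodes T" "nw T" "sw T" "ne T" "se T" x "Suc x"
    using tangle_labels_bounded[OF assms]
    by unfold_locales (auto simp: tangle_labels_def x_def intro: finite_subset)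
  show "numerator_bracket (vertical_twist T) = - Poly_Mapping.single (-3) 1 * numerator_bracket T"
    using vertical_crossing_capped unfolding numerator_bracket_def twist_labels twist by simp
  show "denominator_bracket (vertical_twist T) =
      Poly_Mapping.single 1 1 * denominator_bracket T + Poly_Mapping.single (-1) 1 * numerator_bracket T"
    using vertical_crossing_across
    unfolding numerator_bracket_def denominator_bracket_def twist_labels twist by simp
qed

lemma zero_tangle_brackets:
  "numerator_bracket zero_tangle = loop_value" "denominator_bracket zero_tangle = 1"
  by (simp_all add: numerator_bracket_def denominator_bracket_def zero_tangle_def tangle_labels_def
      labels_def state_sum_Nil loops_two_vertices insert_commute)

lemma infinity_tangle_brackets:
  "numerator_bracket infinity_tangle = 1" "denominator_bracket infinity_tangle = loop_value"
  by (simp_all add: numerator_bracket_def denominator_bracket_def infinity_tangle_def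
      tangle_labels_def labels_def state_sum_Nil loops_two_vertices insert_commute)

section \<open>Tangles of a given fraction\<close>

inductive fraction_tangle :: "nat \<Rightarrow> nat \<Rightarrow> tangle \<Rightarrow> bool" where
  zero: "fraction_tangle 0 1 zero_tangle"
| infinity: "fraction_tangle 1 0 infinity_tangle"
| horizontal: "fraction_tangle p q T \<Longrightarrow> fraction_tangle (p + q) q (horizontal_twist T)"
| vertical: "fraction_tangle p q T \<Longrightarrow> fraction_tangle p (p + q) (vertical_twist T)"

lemma fraction_tangle_coprime: "fraction_tangle p q T \<Longrightarrow> coprime p q"
  by (induction rule: fraction_tangle.induct) (simp_all add: coprime_iff_gcd_eq_1)

lemma fraction_tangle_bounded_labels: "fraction_tangle p q T \<Longrightarrow> bounded_labels T"
  by (induction rule: fraction_tangle.induct)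
    (simp_all add: bounded_labels_twist,
      simp_all add: bounded_labels_def labels_def zero_tangle_def infinity_tangle_def)

lemma fraction_tangle_horizontal_funpow:
  "fraction_tangle p q T \<Longrightarrow> fraction_tangle (p + n * q) q ((horizontal_twist ^^ n) T)"
proof (induction n)
  case (Suc n)
  then show ?case
    using fraction_tangle.horizontal[of "p + n * q" q] by (simp add: algebra_simps)
qed simp

lemma fraction_tangle_vertical_funpow:
  "fraction_tangle p q T \<Longrightarrow> fraction_tangle p (q + n * p) ((vertical_twist ^^ n) T)"
proof (induction n)
  case (Suc n)
  then show ?case
    using fraction_tangle.vertical[of p "q + n * p"] by (simp add: algebra_simps)
qed simp

lemma fraction_tangle_rational_tangle:
  assumes "coprime p q"
  shows "fraction_tangle p q (rational_tangle True (cfrac p q))"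
    and "fraction_tangle q p (rational_tangle False (cfrac p q))"
  using assms
proof (induction p q rule: cfrac.induct)
  case (1 p q)
  {
    case 1
    then show ?case
    proof (cases "q = 0")
      case False
      then have "fraction_tangle (p mod q) q (rational_tangle False (cfrac q (p mod q)))"
        using "1.IH"(2) 1 by (simp add: coprime_commute)
      then show ?thesis
        using fraction_tangle_horizontal_funpow[of "p mod q" q _ "p div q"] False
        by (simp add: cfrac.simps[of p q])
    qed (use fraction_tangle.infinity in \<open>simp add: cfrac.simps[of _ 0]\<close>)
  next
    case 2
    then show ?case
    proof (cases "q = 0")
      case False
      then have "fraction_tangle q (p mod q) (rational_tangle True (cfrac q (p mod q)))"
        using "1.IH"(1) 2 by (simp add: coprime_commute)
      then show ?thesis
        using fraction_tangle_vertical_funpow[of q "p mod q" _ "p div q"] False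
        by (simp add: cfrac.simps[of p q])
    qed (use fraction_tangle.zero in \<open>simp add: cfrac.simps[of _ 0]\<close>)
  }
qed

lemma homogeneous_twist_sum:
  assumes "homogeneous_mod 4 (e + 2) p" and "homogeneous_mod 4 e q"
  shows "homogeneous_mod 4 (e + 1) (Poly_Mapping.single 1 1 * q + Poly_Mapping.single (-1) 1 * p)"
  using homogeneous_mod_add homogeneous_mod_monomial_mult[OF assms(2), of 1 1]
    homogeneous_mod_monomial_mult[OF assms(1), of "-1" 1]
  by (simp add: add.commute)

lemma homogeneous_fraction_tangle:
  assumes "fraction_tangle p q T"
  shows "\<exists>e. homogeneous_mod 4 (e + 2) (numerator_bracket T) \<and>
    homogeneous_mod 4 e (denominator_bracket T)"
  using assms
proof (induction rule: fraction_tangle.induct)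
  case zero
  have "homogeneous_mod 4 0 1"
    by (simp add: homogeneous_mod_def)
  then show ?case
    by (intro exI[of _ 0]) (simp add: zero_tangle_brackets homogeneous_mod_loop_value)
next
  case infinity
  have "homogeneous_mod 4 4 1"
    by (simp add: homogeneous_mod_def cong_def)
  then show ?case
    by (intro exI[of _ 2]) (simp add: infinity_tangle_brackets homogeneous_mod_loop_value)
next
  case (horizontal p q T)
  then obtain e where e: "homogeneous_mod 4 (e + 2) (numerator_bracket T)"
    "homogeneous_mod 4 e (denominator_bracket T)"
    by blast
  have "homogeneous_mod 4 (e - 1) (- (Poly_Mapping.single 3 1 * denominator_bracket T))"
    using homogeneous_mod_uminus[OF homogeneous_mod_monomial_mult[OF e(2)]]
    by (rule homogeneous_mod_cong) (simp add: cong_iff_dvd_diff)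
  then show ?case
    using homogeneous_twist_sum[OF e]
    by (intro exI[of _ "e - 1"]) (simp add: horizontal_twist_brackets
        fraction_tangle_bounded_labels[OF horizontal.hyps] add.commute)
next
  case (vertical p q T)
  then obtain e where e: "homogeneous_mod 4 (e + 2) (numerator_bracket T)"
    "homogeneous_mod 4 e (denominator_bracket T)"
    by blast
  have "homogeneous_mod 4 (e + 3) (- (Poly_Mapping.single (-3) 1 * numerator_bracket T))"
    using homogeneous_mod_uminus[OF homogeneous_mod_monomial_mult[OF e(1)]]
    by (rule homogeneous_mod_cong) (simp add: cong_iff_dvd_diff)
  then show ?case
    using homogeneous_twist_sum[OF e]
    by (intro exI[of _ "e + 1"]) (simp add: vertical_twist_brackets
        fraction_tangle_bounded_labels[OF vertical.hyps] add.commute)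
qed

section \<open>The bracket at a primitive 16th root of unity\<close>

text \<open>
  A twist replaces \<open>N\<close> or \<open>D\<close> by \<open>A D + A\<^sup>-\<^sup>1 N\<close>, whose absolute value depends also on the product of
  \<open>N\<close> and the conjugate of \<open>D\<close>, so this product has to be tracked as well. The values are those of
  \<open>- A\<^sup>2 N\<close> times the conjugate of \<open>D\<close> for the integer tangles \<open>n / 1\<close>.
\<close>

definition mod4_value :: "nat \<Rightarrow> complex" where
  "mod4_value n = [1 - \<i>, - \<i>, 0, 1] ! (n mod 4)"

lemma mod4_cases:
  fixes n :: nat
  obtains "n mod 4 = 0" | "n mod 4 = 1" | "n mod 4 = 2" | "n mod 4 = 3"
  by linarith

lemma mod4_value_add:
  assumes "odd p \<or> odd q"
  shows "(cmod (mod4_value (p + q)))\<^sup>2 =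
      (cmod (mod4_value p))\<^sup>2 + (cmod (mod4_value q))\<^sup>2 + 2 * Im (mod4_value (p * q))"
    and "mod4_value ((p + q) * q) = (cmod (mod4_value q))\<^sup>2 - \<i> * mod4_value (p * q)"
proof -
  have reduce: "(p + q) mod 4 = (p mod 4 + q mod 4) mod 4"
    "p * q mod 4 = (p mod 4) * (q mod 4) mod 4"
    "(p + q) * q mod 4 = ((p mod 4 + q mod 4) mod 4) * (q mod 4) mod 4"
    by (simp_all only: mod_add_eq mod_mult_eq)
  have odd: "odd (p mod 4) \<or> odd (q mod 4)"
    using assms by presburger
  show "(cmod (mod4_value (p + q)))\<^sup>2 =
      (cmod (mod4_value p))\<^sup>2 + (cmod (mod4_value q))\<^sup>2 + 2 * Im (mod4_value (p * q))"
    unfolding mod4_value_def reduce using odd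
    by (cases p rule: mod4_cases; cases q rule: mod4_cases) (simp_all add: cmod_power2)
  show "mod4_value ((p + q) * q) = (cmod (mod4_value q))\<^sup>2 - \<i> * mod4_value (p * q)"
    unfolding mod4_value_def reduce using odd
    by (cases p rule: mod4_cases; cases q rule: mod4_cases) (simp_all add: cmod_power2 complex_eq_iff)
qed

definition mod4_brackets :: "complex \<Rightarrow> nat \<Rightarrow> nat \<Rightarrow> complex \<Rightarrow> complex \<Rightarrow> bool" where
  "mod4_brackets A p q a b \<longleftrightarrow> cmod a = cmod (mod4_value p) \<and> cmod b = cmod (mod4_value q) \<and>
     A\<^sup>2 * a * cnj b = - mod4_value (p * q)"

text \<open>As \<open>A\<close> has absolute value 1, conjugation exchanges the effects of the two kinds of twists.\<close>

lemma mod4_brackets_swap: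
  "mod4_brackets A p q a b \<Longrightarrow> mod4_brackets A q p (cnj b) (cnj a)"
  by (simp add: mod4_brackets_def mult_ac)

lemma inverse_eq_cnj: "cmod A = 1 \<Longrightarrow> inverse A = cnj A"
  by (simp add: inverse_complex_def complex_eq_iff cmod_def)

lemma cmod_add_squared:
  "(cmod (x + y))\<^sup>2 = (cmod x)\<^sup>2 + (cmod y)\<^sup>2 + 2 * Re (x * cnj y)"
  unfolding cmod_power2 by (simp add: power2_eq_square algebra_simps)

lemma cmod_eq_1_if_power4_eq_neg_ii: "A ^ 4 = - \<i> \<Longrightarrow> cmod A = 1"
  using power_eq_1_iff[of A 16] power_mult[of A 4 4] by simp

lemma mod4_brackets_horizontal:
  assumes A: "A ^ 4 = - \<i>" and "odd p \<or> odd q" and ab: "mod4_brackets A p q a b"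
  shows "mod4_brackets A (p + q) q (A * b + inverse A * a) (- (A ^ 3) * b)"
proof -
  have unit: "cmod A = 1"
    using A by (rule cmod_eq_1_if_power4_eq_neg_ii)
  have cnj: "A * cnj A = 1" "inverse A = cnj A"
    using unit by (simp_all add: inverse_eq_cnj complex_norm_square[symmetric])
  have norms: "cmod a = cmod (mod4_value p)" "cmod b = cmod (mod4_value q)"
    and pairing: "A\<^sup>2 * a * cnj b = - mod4_value (p * q)"
    using ab by (simp_all add: mod4_brackets_def)
  have "(cmod (A * b + inverse A * a))\<^sup>2 = (cmod (mod4_value (p + q)))\<^sup>2"
  proof -
    have "A * b * cnj (inverse A * a) = A ^ 4 * cnj (A\<^sup>2 * a * cnj b)"
      using cnj by (simp, algebra)
    then have "Re (A * b * cnj (inverse A * a)) = Im (mod4_value (p * q))"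
      by (simp only: A pairing) simp
    moreover have "(cmod (A * b + inverse A * a))\<^sup>2 =
        (cmod b)\<^sup>2 + (cmod a)\<^sup>2 + 2 * Re (A * b * cnj (inverse A * a))"
      using cmod_add_squared[of "A * b" "inverse A * a"] unit by (simp add: norm_mult norm_inverse)
    ultimately show ?thesis
      using mod4_value_add(1)[OF assms(2)] norms by simp
  qed
  then have "cmod (A * b + inverse A * a) = cmod (mod4_value (p + q))"
    by (rule power2_eq_imp_eq) simp_all
  moreover have "A\<^sup>2 * (A * b + inverse A * a) * cnj (- (A ^ 3) * b) = - mod4_value ((p + q) * q)"
  proof -
    have "A\<^sup>2 * (A * b + inverse A * a) * cnj (- (A ^ 3) * b) =
        - (b * cnj b) - (cnj A) ^ 4 * (A\<^sup>2 * a * cnj b)"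
      unfolding cnj(2) using cnj(1) by (simp, algebra)
    also have "(cnj A) ^ 4 = \<i>"
      using arg_cong[OF A, of cnj] by simp
    also have "b * cnj b = (cmod (mod4_value q))\<^sup>2"
      by (simp add: norms(2)[symmetric] complex_norm_square del: of_real_power)
    finally show ?thesis
      by (simp add: pairing mod4_value_add(2)[OF assms(2)])
  qed
  ultimately show ?thesis
    using unit norms(2) by (simp add: mod4_brackets_def norm_mult norm_power)
qed

lemma mod4_brackets_vertical:
  assumes A: "A ^ 4 = - \<i>" and "odd p \<or> odd q" and "mod4_brackets A p q a b"
  shows "mod4_brackets A p (p + q) (- (inverse A ^ 3) * a) (A * b + inverse A * a)"
proof -
  have cnj: "cnj A = inverse A"
    using inverse_eq_cnj[OF cmod_eq_1_if_power4_eq_neg_ii[OF A]] by simp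
  have "mod4_brackets A (q + p) p (A * cnj a + inverse A * cnj b) (- (A ^ 3) * cnj a)"
    using assms by (intro mod4_brackets_horizontal mod4_brackets_swap) auto
  from mod4_brackets_swap[OF this] show ?thesis
    by (simp add: cnj add.commute)
qed

lemma laurent_eval_loop_value: "laurent_eval z loop_value = - (z\<^sup>2 + (inverse z)\<^sup>2)"
  by (simp add: loop_value_def laurent_eval_diff laurent_eval_uminus power_int_minus power_inverse)

lemma cnj_laurent_eval_loop_value:
  assumes "cmod A = 1"
  shows "cnj (laurent_eval A loop_value) = laurent_eval A loop_value"
proof -
  have "cnj A = inverse A"
    using assms by (simp add: inverse_eq_cnj)
  then show ?thesis
    by (simp add: laurent_eval_loop_value)
qed

lemma mod4_brackets_infinity:
  assumes "A ^ 4 = - \<i>"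
  shows "mod4_brackets A 1 0 1 (laurent_eval A loop_value)"
proof -
  have A: "A \<noteq> 0" "cmod A = 1"
    using assms cmod_eq_1_if_power4_eq_neg_ii by auto
  then have "A\<^sup>2 * laurent_eval A loop_value = - (A ^ 4) - 1"
    unfolding laurent_eval_loop_value by (simp add: field_simps flip: power_add)
  then have pairing: "A\<^sup>2 * laurent_eval A loop_value = - (1 - \<i>)"
    by (simp add: assms)
  have "cmod (laurent_eval A loop_value) = cmod (A\<^sup>2 * laurent_eval A loop_value)"
    using A(2) by (simp add: norm_mult norm_power)
  also have "\<dots> = cmod (1 - \<i>)"
    by (simp only: pairing norm_minus_cancel)
  finally show ?thesis
    using cnj_laurent_eval_loop_value[OF A(2)] pairing by (simp add: mod4_brackets_def mod4_value_def)
qed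

lemma mod4_brackets_fraction_tangle:
  assumes A: "A ^ 4 = - \<i>" and "fraction_tangle p q T"
  shows "mod4_brackets A p q
    (laurent_eval A (numerator_bracket T)) (laurent_eval A (denominator_bracket T))"
  using assms(2)
proof (induction rule: fraction_tangle.induct)
  case zero
  show ?case
    using mod4_brackets_swap[OF mod4_brackets_infinity[OF A]]
      cnj_laurent_eval_loop_value[OF cmod_eq_1_if_power4_eq_neg_ii[OF A]]
    by (simp add: zero_tangle_brackets)
next
  case infinity
  show ?case
    using mod4_brackets_infinity[OF A] by (simp add: infinity_tangle_brackets)
next
  case (horizontal p q T)
  have "odd p \<or> odd q"
    using fraction_tangle_coprime[OF horizontal.hyps] by (meson coprime_common_divisor odd_one)
  moreover have "A \<noteq> 0"
    using A by auto
  ultimately show ?case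
    using mod4_brackets_horizontal[OF A _ horizontal.IH]
    by (simp add: horizontal_twist_brackets fraction_tangle_bounded_labels[OF horizontal.hyps]
        laurent_eval_add laurent_eval_uminus laurent_eval_mult power_int_minus)
next
  case (vertical p q T)
  have "odd p \<or> odd q"
    using fraction_tangle_coprime[OF vertical.hyps] by (meson coprime_common_divisor odd_one)
  moreover have "A \<noteq> 0"
    using A by auto
  ultimately show ?case
    using mod4_brackets_vertical[OF A _ vertical.IH]
    by (simp add: vertical_twist_brackets fraction_tangle_bounded_labels[OF vertical.hyps]
        laurent_eval_add laurent_eval_uminus laurent_eval_mult power_int_minus power_inverse)
qed

section \<open>Gaussian integers of small norm\<close>

definition gaussian_ints :: "complex set" where
  "gaussian_ints = {z. Re z \<in> \<int> \<and> Im z \<in> \<int>}"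

lemma gaussian_ints_of_int: "of_int n \<in> gaussian_ints"
  by (simp add: gaussian_ints_def)

lemma gaussian_ints_mult: "x \<in> gaussian_ints \<Longrightarrow> y \<in> gaussian_ints \<Longrightarrow> x * y \<in> gaussian_ints"
  by (simp add: gaussian_ints_def)

lemma gaussian_ints_sum: "(\<And>x. x \<in> S \<Longrightarrow> f x \<in> gaussian_ints) \<Longrightarrow> (\<Sum>x\<in>S. f x) \<in> gaussian_ints"
  by (simp add: gaussian_ints_def Ints_sum)

lemma gaussian_ints_power: "x \<in> gaussian_ints \<Longrightarrow> x ^ n \<in> gaussian_ints"
  by (induction n) (simp_all add: gaussian_ints_mult gaussian_ints_of_int[of 1, simplified])

lemma gaussian_ints_powi_ii: "\<i> powi k \<in> gaussian_ints"
proof -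
  have "\<i> \<in> gaussian_ints" "inverse \<i> \<in> gaussian_ints"
    by (simp_all add: gaussian_ints_def)
  then show ?thesis
    by (simp add: power_int_def gaussian_ints_power del: inverse_i)
qed

lemma normalized_jones_ii_gaussian_ints: "normalized_jones D ds \<i> \<in> gaussian_ints"
  unfolding normalized_jones_def Let_def
  by (auto intro!: gaussian_ints_mult gaussian_ints_of_int gaussian_ints_sum gaussian_ints_powi_ii)

lemma Ints_abs_less_2:
  fixes x :: real
  assumes "x \<in> \<int>" and "\<bar>x\<bar> < 2"
  shows "x \<in> {- 1, 0, 1}"
proof -
  obtain n where "x = of_int n"
    using assms(1) by (rule Ints_cases)
  moreover from this have "n \<in> {- 1, 0, 1}"
    using assms(2) by auto
  ultimately show ?thesis
    by auto
qed

lemma gaussian_ints_cmod_lt_2_cases: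
  assumes "z \<in> gaussian_ints" and "cmod z < 2"
  shows "Re z \<in> {- 1, 0, 1}" and "Im z \<in> {- 1, 0, 1}"
  using assms Ints_abs_less_2 abs_Re_le_cmod[of z] abs_Im_le_cmod[of z]
  by (auto simp: gaussian_ints_def simp del: insert_iff)

lemma gaussian_ints_cmod_eq_1:
  assumes "z \<in> gaussian_ints" and "cmod z = 1"
  shows "z \<in> {1, - 1, \<i>, - \<i>}"
  using gaussian_ints_cmod_lt_2_cases[of z] assms cmod_power2[of z] by (auto simp: complex_eq_iff)

lemma gaussian_ints_cmod_eq_sqrt_2:
  assumes "z \<in> gaussian_ints" and "cmod z = sqrt 2"
  shows "z \<in> {1 + \<i>, - (1 + \<i>), 1 - \<i>, - (1 - \<i>)}"
  using gaussian_ints_cmod_lt_2_cases[of z] assms cmod_power2[of z] sqrt2_less_2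
  by (auto simp: complex_eq_iff)

section \<open>Rational links\<close>

lemma rational_link_of_fraction:
  assumes "coprime r s" and "r \<ge> 0" "s > 0"
  obtains T where "fraction_tangle (nat r) (nat s) T"
    and "rational_link (of_int r / of_int s) = numerator_closure T"
proof
  show "fraction_tangle (nat r) (nat s) (rational_tangle True (cfrac (nat r) (nat s)))"
    using assms coprime_int_iff[of "nat r" "nat s"] by (intro fraction_tangle_rational_tangle) simp
  show "rational_link (of_int r / of_int s) =
      numerator_closure (rational_tangle True (cfrac (nat r) (nat s)))"
    using assms
    by (simp add: rational_link_def Fract_of_int_quotient[symmetric] quotient_of_Fract)
qed

proposition cmod_normalized_jones_numerator_closure:
  assumes "fraction_tangle p q T" and "length ds = length (numerator_closure T)"
  shows "cmod (normalized_jones (numerator_closure T) ds \<i>) = cmod (mod4_value p)"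
proof -
  define A where "A = cis (- (pi / 8))"
  have A: "A ^ 4 = - \<i>"
    by (simp add: A_def DeMoivre complex_eq_iff del: cis_inverse)
  obtain e where "homogeneous_mod 4 (e + 2) (bracket (numerator_closure T))"
    using homogeneous_fraction_tangle[OF assms(1)] by (auto simp: bracket_numerator_closure)
  then have "cmod (normalized_jones (numerator_closure T) ds \<i>) =
      cmod (laurent_eval A (numerator_bracket T))"
    using cmod_normalized_jones[of A] assms(2) A
    by (simp add: A_def bracket_numerator_closure)
  then show ?thesis
    using mod4_brackets_fraction_tangle[OF A assms(1)] by (simp add: mod4_brackets_def)
qed

theorem theorem8p3:
  fixes r s :: int and \<alpha> :: rat and ds :: "direction list"
  assumes "coprime r s" and "s > 0" and "\<alpha> = of_int r / of_int s" and "\<alpha> > 1"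
    and "is_orientation (rational_link \<alpha>) ds"
  shows "([r = 2] (mod 4) \<longrightarrow> normalized_jones (rational_link \<alpha>) ds \<i> = 0) \<and>
         ([r = 0] (mod 4) \<longrightarrow>
            normalized_jones (rational_link \<alpha>) ds \<i> \<in> {1 + \<i>, - (1 + \<i>), 1 - \<i>, - (1 - \<i>)}) \<and>
         ([r = 1] (mod 4) \<or> [r = 3] (mod 4) \<longrightarrow>
            normalized_jones (rational_link \<alpha>) ds \<i> \<in> {1, - 1, \<i>, - \<i>})"
proof -
  define z where "z = normalized_jones (rational_link \<alpha>) ds \<i>"
  have "of_int s < (of_int r :: rat)"
    using assms(2-4) by (simp add: less_divide_eq)
  then have "r > 0"
    using assms(2) by linarith
  obtain T where "fraction_tangle (nat r) (nat s) T" and link: "rational_link \<alpha> = numerator_closure T"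
    using rational_link_of_fraction assms(1-3) \<open>r > 0\<close> by (metis order_less_imp_le)
  then have cmod_z: "cmod z = cmod (mod4_value (nat r))"
    using cmod_normalized_jones_numerator_closure assms(5) unfolding z_def is_orientation_def link
    by blast
  have gaussian_z: "z \<in> gaussian_ints"
    unfolding z_def by (rule normalized_jones_ii_gaussian_ints)
  have "z = 0" if "nat r mod 4 = 2"
    using that cmod_z by (simp add: mod4_value_def)
  moreover have "z \<in> {1 + \<i>, - (1 + \<i>), 1 - \<i>, - (1 - \<i>)}" if "nat r mod 4 = 0"
    using that cmod_z gaussian_z
    by (intro gaussian_ints_cmod_eq_sqrt_2) (simp_all add: mod4_value_def cmod_def)
  moreover have "z \<in> {1, - 1, \<i>, - \<i>}" if "nat r mod 4 = 1 \<or> nat r mod 4 = 3"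
    using that cmod_z gaussian_z
    by (intro gaussian_ints_cmod_eq_1) (auto simp: mod4_value_def)
  moreover have "r mod 4 = int (nat r mod 4)"
    using \<open>r > 0\<close> by (simp add: zmod_int)
  ultimately show ?thesis
    unfolding z_def[symmetric] cong_def by simp
qed

end
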